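(* Let $d\ge2$ and let $\Lambda\subseteq\tilde{\mathcal K}^d$ be a lattice. Then $\operatorname{CovRad}_{\mathcal O^d}(\Lambda)=q^{-1}\lambda_d(\Lambda)$.
   Context: Let $q$ be a prime power, $\mathcal R=\mathbb F_q[x]$, and $\tilde{\mathcal K}=\mathbb F_q((x^{-1}))$, with the absolute value $|\cdot|$ extending $|f|=q^{\deg f}$ for nonzero $f\in\mathcal R$ (and $|0|=0$); $\mathcal O=\mathbb F_q[[x^{-1}]]=\{f\in\tilde{\mathcal K}:|f|\le1\}$. On $\tilde{\mathcal K}^d$ use the norm $\|\mathbf v\|=\max_i|v_i|$. A lattice in $\tilde{\mathcal K}^d$ is a set $\Lambda=g\mathcal R^d$ with $g\in\mathrm{GL}_d(\tilde{\mathcal K})$. For $i=1,\dots,d$, $\lambda_i(\Lambda)=\min\{r>0:\text{ there exist } i \text{ linearly independent vectors in }\Lambda\text{ of norm}\le r\}$. For real $r>0$, $r\mathcal O^d=\{\mathbf v\in\tilde{\mathcal K}^d:\|\mathbf v\|\le r\}$, and $\operatorname{CovRad}_{\mathcal O^d}(\Lambda)$ is the smallest $r>0$ such that $\Lambda+r\mathcal O^d=\tilde{\mathcal K}^d$. *)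

theory Defs
  imports "HOL-Analysis.Cartesian_Space" "HOL-Computational_Algebra.Formal_Laurent_Series"
begin

text \<open>
  A type \<open>'a\<close> of sorts \<open>field\<close> and \<open>finite\<close> plays the role of $\mathbb{F}_q$, with
  \<open>q = CARD('a)\<close>. The field $\mathbb{F}_q((x^{-1}))$ is the type \<open>'a fls\<close>, whose formal variable
  \<open>fls_X\<close> is read as $x^{-1}$; thus $x$ itself is \<open>fls_X_inv\<close>. Vectors are indexed by a finite
  type \<open>'d\<close>, with \<open>d = CARD('d)\<close>.
\<close>

definition poly_to_fls :: "'a::field poly \<Rightarrow> 'a fls" where
  "poly_to_fls p = poly (map_poly fls_const p) fls_X_inv"

text \<open>\<open>fls_subdegree f\<close> is the least exponent of $x^{-1}$ occurring in \<open>f\<close>, hence minus the degree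
  of \<open>f\<close> in $x$.\<close>

definition fls_abs :: "'a::{field,finite} fls \<Rightarrow> real" where
  "fls_abs f = (if f = 0 then 0 else real CARD('a) powi (- fls_subdegree f))"

lemma poly_to_fls_nth:
  "fls_nth (poly_to_fls p) n = (if n \<le> 0 then coeff p (nat (- n)) else 0)"
proof (induction p arbitrary: n)
  case 0
  then show ?case by (simp add: poly_to_fls_def)
next
  case (pCons a p)
  have "poly_to_fls (pCons a p) = fls_const a + fls_X_inv * poly_to_fls p"
    by (simp add: poly_to_fls_def map_poly_pCons)
  moreover have "nat (- n) = Suc (nat (- (n + 1)))" if "n < 0"
    using that by simp
  ultimately show ?case
    by (cases "n < 0") (auto simp: fls_X_inv_times_conv_shift pCons.IH coeff_pCons split: nat.splits)
qed

lemma fls_abs_poly_to_fls: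
  fixes p :: "'a::{field,finite} poly"
  assumes "p \<noteq> 0"
  shows "fls_abs (poly_to_fls p) = real CARD('a) ^ degree p"
proof -
  have "fls_nth (poly_to_fls p) (- int (degree p)) \<noteq> 0"
    using assms by (simp add: poly_to_fls_nth)
  moreover have "fls_nth (poly_to_fls p) k = 0" if "k < - int (degree p)" for k
    using that by (simp add: poly_to_fls_nth coeff_eq_0)
  ultimately have "fls_subdegree (poly_to_fls p) = - int (degree p)"
    by (rule fls_subdegree_eqI)
  moreover have "poly_to_fls p \<noteq> 0"
    using \<open>fls_nth (poly_to_fls p) (- int (degree p)) \<noteq> 0\<close> by auto
  ultimately show ?thesis
    by (simp add: fls_abs_def)
qed

definition fls_vec_norm :: "'a::{field,finite} fls ^ 'd \<Rightarrow> real" where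
  "fls_vec_norm v = Max (range (\<lambda>i. fls_abs (v $ i)))"

definition is_lattice :: "('a::{field,finite} fls ^ 'd) set \<Rightarrow> bool" where
  "is_lattice L \<longleftrightarrow>
     (\<exists>g :: 'a fls ^ 'd ^ 'd. invertible g \<and>
        L = (\<lambda>v. g *v v) ` {v. \<forall>i. v $ i \<in> range poly_to_fls})"

text \<open>The definitions of \<open>successive_minimum\<close> and \<open>covering_radius\<close> use minima, not infima: \<open>LEAST\<close> on the reals denotes the least element of
  the set of admissible radii and is unspecified if there is none. Linear independence is over
  $\mathbb{F}_q((x^{-1}))$.\<close>

definition successive_minimum :: "nat \<Rightarrow> ('a::{field,finite} fls ^ 'd) set \<Rightarrow> real" where
  "successive_minimum i L =
     (LEAST r. r > 0 \<and>
        (\<exists>S \<subseteq> L. finite S \<and> card S = i \<and> vec.independent S \<and> (\<forall>v\<in>S. fls_vec_norm v \<le> r)))"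

definition scaled_integer_ball :: "real \<Rightarrow> ('a::{field,finite} fls ^ 'd) set" where
  "scaled_integer_ball r = {v. fls_vec_norm v \<le> r}"

definition covering_radius :: "('a::{field,finite} fls ^ 'd) set \<Rightarrow> real" where
  "covering_radius L =
     (LEAST r. r > 0 \<and> {u + v |u v. u \<in> L \<and> v \<in> scaled_integer_ball r} = UNIV)"

end

theory Submission
  imports Defs
begin

text \<open>
  Call \<open>r\<close> a spanning radius of the lattice if the ball of radius \<open>r\<close> contains \<open>d\<close> independent
  lattice vectors, and a covering radius if the translates of that ball by lattice vectors cover the
  space. With \<open>q = CARD('a)\<close>, the claim is that \<open>r\<close> is covering exactly when \<open>q * r\<close> is spanning,
  and that there is a least spanning radius; the two minima then differ by the factor \<open>q\<close>.

  Spanning implies covering (\<open>spanning_radius_imp_covers_within\<close>): write a vector in terms of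
  \<open>d\<close> independent lattice vectors of norm at most \<open>r\<close> and remove the polynomial part of every
  coefficient. The coefficients that remain have absolute value at most \<open>1/q\<close>, so by the ultrametric
  inequality the remainder has norm at most \<open>r/q\<close>, with no loss from the number of summands.

  Covering implies spanning (\<open>covers_within_imp_spanning_radius\<close>): norms take only the value \<open>0\<close> and
  powers of \<open>q\<close>, so \<open>r\<close> may be lowered to a power of \<open>q\<close>. Choose a scalar \<open>z\<close> of absolute value
  \<open>q * r\<close>, and lattice vectors within \<open>r\<close> of the multiples by \<open>z\<close> of the standard basis vectors.
  These lattice vectors have norm at most \<open>q * r\<close>. They are independent because the matrix they form
  is \<open>z\<close> times a perturbation of the identity by entries of absolute value less than 1
  (\<open>independent_near_scaled_axes\<close>).

  A least spanning radius exists (\<open>spanning_radius_has_least\<close>) because nonzero lattice vectors have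
  norms bounded away from zero (\<open>lattice_discrete\<close>), and the powers of \<open>q\<close> above a positive bound
  are well-ordered.
\<close>

(* Both vector components and coefficients of formal power series are written with a dollar sign;
   only the former occur below. *)
unbundle no Formal_Power_Series.fps_syntax

section \<open>The absolute value\<close>

lemma finite_field_card_gt_1: "1 < real CARD('a::{field,finite})"
proof -
  have "card {0, 1 :: 'a} \<le> CARD('a)"
    by (rule card_mono) auto
  then show ?thesis by simp
qed

lemma fls_abs_0 [simp]: "fls_abs 0 = 0"
  by (simp add: fls_abs_def)

lemma fls_abs_nonneg [simp]: "0 \<le> fls_abs f"
  by (simp add: fls_abs_def)

lemma fls_abs_pos: "f \<noteq> 0 \<Longrightarrow> 0 < fls_abs f"
  by (simp add: fls_abs_def)

lemma fls_abs_uminus [simp]: "fls_abs (- f) = fls_abs f"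
  by (simp add: fls_abs_def)

lemma fls_abs_mult:
  fixes f g :: "'a::{field,finite} fls"
  shows "fls_abs (f * g) = fls_abs f * fls_abs g"
  using finite_field_card_gt_1[where 'a = 'a]
  by (auto simp: fls_abs_def simp flip: power_int_add)

lemma card_powi_le_iff:
  "real CARD('a::{field,finite}) powi m \<le> real CARD('a) powi n \<longleftrightarrow> m \<le> n"
  using finite_field_card_gt_1[where 'a = 'a] power_int_increasing[of m n "real CARD('a)"]
    power_int_strict_increasing[of n m "real CARD('a)"]
  by linarith

text \<open>Balls are described by vanishing of coefficients. This makes the ultrametric inequality and the
  bound on fractional parts statements about individual coefficients.\<close>

lemma fls_abs_le_powi_iff:
  fixes f :: "'a::{field,finite} fls"
  shows "fls_abs f \<le> real CARD('a) powi m \<longleftrightarrow> (\<forall>k < - m. fls_nth f k = 0)"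
proof (cases "f = 0")
  case False
  have "- fls_subdegree f \<le> m \<longleftrightarrow> (\<forall>k < - m. fls_nth f k = 0)"
    using fls_subdegree_geI[OF False, of "- m"] by (auto simp: minus_le_iff)
  with False show ?thesis
    by (simp add: fls_abs_def card_powi_le_iff)
qed simp

lemma fls_abs_add_le: "fls_abs (f + g) \<le> max (fls_abs f) (fls_abs g)"
proof (cases "f = 0 \<or> g = 0")
  case False
  define m where "m = max (- fls_subdegree f) (- fls_subdegree g)"
  have *: "max (fls_abs f) (fls_abs g) = real CARD('a) powi m"
    using False unfolding fls_abs_def m_def
    by (simp add: max_def card_powi_le_iff)
  have "\<forall>k < - m. fls_nth (f + g) k = 0"
    by (auto simp: m_def)
  then show ?thesis
    unfolding * by (simp only: fls_abs_le_powi_iff)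
qed auto

lemma fls_abs_sum_le:
  assumes "0 \<le> B" "\<And>j. j \<in> J \<Longrightarrow> fls_abs (f j) \<le> B"
  shows "fls_abs (\<Sum>j\<in>J. f j) \<le> B"
  using assms(2)
proof (induction J rule: infinite_finite_induct)
  case (insert j J)
  then show ?case
    using fls_abs_add_le[of "f j" "\<Sum>j\<in>J. f j"] by force
qed (use assms(1) in auto)

lemma fls_abs_X_inv_powi:
  "fls_abs ((fls_X_inv :: 'a::{field,finite} fls) powi m) = real CARD('a) powi m"
  by (simp add: fls_abs_def fls_subdegree_power_int)

text \<open>The exponent is the integer part of the logarithm of \<open>r\<close> to base \<open>q\<close>.\<close>

lemma powi_floor_le:
  assumes "0 < r"
  obtains k where "real CARD('a::{field,finite}) powi k \<le> r"
    "\<And>m. real CARD('a) powi m \<le> r \<Longrightarrow> m \<le> k"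
proof -
  let ?q = "real CARD('a)"
  note q = finite_field_card_gt_1[where 'a = 'a]
  have "?q powi m \<le> r \<longleftrightarrow> m \<le> \<lfloor>log ?q r\<rfloor>" for m
    using q assms by (simp add: le_floor_iff le_log_iff powr_real_of_int')
  then show thesis using that by blast
qed

section \<open>The maximum norm\<close>

lemma fls_vec_norm_le_iff: "fls_vec_norm v \<le> r \<longleftrightarrow> (\<forall>i. fls_abs (v $ i) \<le> r)"
  by (auto simp: fls_vec_norm_def)

lemma fls_abs_component_le: "fls_abs (v $ i) \<le> fls_vec_norm v"
  using fls_vec_norm_le_iff[of v "fls_vec_norm v"] by simp

lemma fls_vec_norm_nonneg [simp]: "0 \<le> fls_vec_norm v"
  by (rule order_trans[OF fls_abs_nonneg fls_abs_component_le])

text \<open>Norms take values in \<open>0\<close> and the powers of \<open>q\<close>, so balls only change at powers of \<open>q\<close>.\<close>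

lemma radius_round_down:
  assumes "0 < r"
  obtains k where "real CARD('a) powi k \<le> r"
    "\<And>v :: 'a::{field,finite} fls ^ 'd. fls_vec_norm v \<le> r \<longleftrightarrow> fls_vec_norm v \<le> real CARD('a) powi k"
proof -
  obtain k where k: "real CARD('a) powi k \<le> r" "\<And>m. real CARD('a) powi m \<le> r \<Longrightarrow> m \<le> k"
    using powi_floor_le[OF assms, where 'a = 'a] by blast
  have "fls_abs f \<le> r \<longleftrightarrow> fls_abs f \<le> real CARD('a) powi k" for f :: "'a fls"
    using k assms order_trans[of "real CARD('a) powi (- fls_subdegree f)" "real CARD('a) powi k" r]
    by (auto simp: fls_abs_def card_powi_le_iff)
  then show thesis
    using that k(1) by (simp add: fls_vec_norm_le_iff)
qed

section \<open>Polynomials inside Laurent series\<close>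

text \<open>Since the formal variable stands for $x^{-1}$, polynomials in $x$ are the series without
  positive exponents. This turns closure properties of the polynomials into coefficient computations.\<close>

lemma range_poly_to_fls_iff: "f \<in> range poly_to_fls \<longleftrightarrow> (\<forall>n > 0. fls_nth f n = 0)"
proof
  assume f: "\<forall>n > 0. fls_nth f n = 0"
  have "f = poly_to_fls (fls_prpart f + [:fls_nth f 0:])"
    by (rule fls_eqI) (use f in \<open>auto simp: poly_to_fls_nth coeff_pCons split: nat.splits\<close>)
  then show "f \<in> range poly_to_fls" by blast
qed (auto simp: poly_to_fls_nth)

lemma poly_to_fls_mult_closed:
  fixes g :: "'a::field fls"
  assumes "g \<in> range poly_to_fls"
  shows "poly_to_fls p * g \<in> range poly_to_fls"
proof (induction p)
  case 0
  have "poly_to_fls (0 :: 'a poly) = 0" by (simp add: poly_to_fls_def)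
  then show ?case by (simp add: range_poly_to_fls_iff)
next
  case (pCons a p)
  have "poly_to_fls (pCons a p) * g = fls_const a * g + fls_X_inv * (poly_to_fls p * g)"
    by (simp add: poly_to_fls_def map_poly_pCons algebra_simps)
  with pCons.IH assms show ?case
    by (simp add: range_poly_to_fls_iff fls_X_inv_times_conv_shift)
qed

lemma range_poly_to_fls_mult:
  "f \<in> range poly_to_fls \<Longrightarrow> g \<in> range poly_to_fls \<Longrightarrow> f * g \<in> range poly_to_fls"
  using poly_to_fls_mult_closed by blast

text \<open>The factor \<open>1/q\<close> in the theorem arises here: after removing the polynomial part, only exponents
  of $x^{-1}$ that are at least 1 remain. The principal part \<open>fls_prpart\<close> omits the constant coefficient,
  which has to be added to obtain the full polynomial part.\<close>

lemma poly_to_fls_fractional_part: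
  fixes f :: "'a::{field,finite} fls"
  obtains p where "fls_abs (f - poly_to_fls p) \<le> inverse (real CARD('a))"
proof -
  let ?p = "fls_prpart f + [:fls_nth f 0:]"
  have "fls_nth (f - poly_to_fls ?p) k = 0" if "k < 1" for k
    using that by (cases "k = 0") (auto simp: poly_to_fls_nth coeff_pCons split: nat.splits)
  then have "fls_abs (f - poly_to_fls ?p) \<le> real CARD('a) powi (- 1)"
    unfolding fls_abs_le_powi_iff by (simp only: minus_minus) blast
  then show thesis using that by simp
qed

section \<open>Lattices\<close>

lemma lattice_combination:
  fixes L :: "('a::{field,finite} fls ^ 'd) set"
  assumes "is_lattice L" "\<And>s. s \<in> S \<Longrightarrow> s \<in> L" "\<And>s. s \<in> S \<Longrightarrow> a s \<in> range poly_to_fls"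
  shows "(\<Sum>s\<in>S. a s *s s) \<in> L"
proof -
  obtain g :: "'a fls ^ 'd ^ 'd" where L: "L = (\<lambda>v. g *v v) ` {v. \<forall>i. v $ i \<in> range poly_to_fls}"
    using assms(1) unfolding is_lattice_def by blast
  have zero: "0 \<in> L"
    unfolding L by (rule image_eqI[of _ _ 0]) (auto simp: range_poly_to_fls_iff)
  have add: "u + v \<in> L" if u: "u \<in> L" and v: "v \<in> L" for u v
  proof -
    obtain x where "u = g *v x" "\<And>i. x $ i \<in> range poly_to_fls"
      using u unfolding L by blast
    moreover obtain y where "v = g *v y" "\<And>i. y $ i \<in> range poly_to_fls"
      using v unfolding L by blast
    ultimately show ?thesis
      unfolding L
      by (intro image_eqI[of _ _ "x + y"])
        (simp_all add: matrix_vector_right_distrib range_poly_to_fls_iff)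
  qed
  have scale: "c *s u \<in> L" if c: "c \<in> range poly_to_fls" and u: "u \<in> L" for c u
  proof -
    obtain x where x: "u = g *v x" "\<And>i. x $ i \<in> range poly_to_fls"
      using u unfolding L by blast
    have "g *v (c *s x) = c *s (g *v x)"
      by (simp add: vec.scale)
    with x c show ?thesis
      unfolding L
      by (intro image_eqI[of _ _ "c *s x"]) (simp_all only: range_poly_to_fls_mult vector_smult_component mem_Collect_eq simp_thms)
  qed
  show ?thesis
    using assms(2,3)
    by (induction S rule: infinite_finite_induct) (auto intro!: zero add scale simp del: vector_add_component)
qed

text \<open>A nonzero lattice vector \<open>v\<close> is \<open>g *v x\<close> with \<open>x\<close> a nonzero vector of polynomials, hence some
  coordinate of \<open>x\<close> has absolute value at least 1. As \<open>x\<close> is the image of \<open>v\<close> under the inverse of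
  \<open>g\<close>, the norm of \<open>v\<close> cannot be smaller than the inverse of a bound for the entries of that
  matrix.\<close>

lemma lattice_discrete:
  fixes L :: "('a::{field,finite} fls ^ 'd) set"
  assumes "is_lattice L"
  obtains e where "0 < e" "\<And>v. v \<in> L \<Longrightarrow> v \<noteq> 0 \<Longrightarrow> e \<le> fls_vec_norm v"
proof -
  obtain g :: "'a fls ^ 'd ^ 'd" where "invertible g"
    and L: "L = (\<lambda>v. g *v v) ` {v. \<forall>i. v $ i \<in> range poly_to_fls}"
    using assms unfolding is_lattice_def by blast
  then obtain h where h: "h ** g = mat 1"
    unfolding invertible_def by blast
  define C where "C = (\<Sum>i\<in>UNIV. \<Sum>j\<in>UNIV. fls_abs (h $ i $ j)) + 1"
  have hC: "fls_abs (h $ i $ j) \<le> C" for i j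
  proof -
    have "fls_abs (h $ i $ j) \<le> (\<Sum>j\<in>UNIV. fls_abs (h $ i $ j))"
      by (rule member_le_sum) auto
    also have "\<dots> \<le> (\<Sum>i\<in>UNIV. \<Sum>j\<in>UNIV. fls_abs (h $ i $ j))"
      by (rule member_le_sum[of i UNIV "\<lambda>i. \<Sum>j\<in>UNIV. fls_abs (h $ i $ j)"])
        (auto intro: sum_nonneg)
    finally show ?thesis by (simp add: C_def)
  qed
  have "0 < C"
    unfolding C_def by (intro add_nonneg_pos sum_nonneg) auto
  have "inverse C \<le> fls_vec_norm v" if v: "v \<in> L" "v \<noteq> 0" for v
  proof -
    obtain x where x: "v = g *v x" "\<And>i. x $ i \<in> range poly_to_fls"
      using v unfolding L by blast
    then have xv: "x = h *v v"
      by (simp add: matrix_vector_mul_assoc h)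
    have "x \<noteq> 0" using v x by auto
    then obtain i where i: "x $ i \<noteq> 0" by (auto simp: vec_eq_iff)
    obtain p where p: "x $ i = poly_to_fls p" using x by blast
    have "p \<noteq> 0" using i p by (auto simp: poly_to_fls_def)
    then have "1 \<le> fls_abs (x $ i)"
      unfolding p using finite_field_card_gt_1[where 'a = 'a]
      by (simp add: fls_abs_poly_to_fls)
    also have "\<dots> \<le> C * fls_vec_norm v"
      unfolding xv matrix_vector_mult_def
      using \<open>0 < C\<close>
      by (auto intro!: fls_abs_sum_le mult_mono hC fls_abs_component_le simp: fls_abs_mult)
    finally show ?thesis using \<open>0 < C\<close> by (simp add: field_simps)
  qed
  with \<open>0 < C\<close> that show thesis by (meson inverse_positive_iff_positive)
qed

section \<open>Independent families\<close>

text \<open>The successive minima count vectors in a set, so a family indexed by coordinates also has to be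
  shown injective; a coincidence \<open>u i = u j\<close> would be a nontrivial relation.\<close>

lemma independent_range_if_scalars_zero:
  fixes u :: "'d::finite \<Rightarrow> 'k::field ^ 'n"
  assumes zero: "\<forall>c. (\<Sum>i\<in>UNIV. c i *s u i) = 0 \<longrightarrow> (\<forall>i. c i = 0)"
  shows "vec.independent (range u)" "card (range u) = CARD('d)"
proof -
  have "inj u"
  proof (rule injI, rule ccontr)
    fix i j assume ij: "u i = u j" "i \<noteq> j"
    have "(\<Sum>k\<in>UNIV. ((if k = i then 1 else 0) - (if k = j then 1 else 0)) *s u k) = u i - u j"
      by (simp add: vec.scale_left_diff_distrib sum_subtractf if_distrib[of "\<lambda>c. c *s _"] cong: if_cong)
    from zero[rule_format, OF this[unfolded ij(1) diff_self], of i] ij(2) show False by simp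
  qed
  then show "card (range u) = CARD('d)" by (rule card_image)
  show "vec.independent (range u)"
  proof (rule vec.independent_if_scalars_zero)
    fix f x assume "(\<Sum>x\<in>range u. f x *s x) = 0" "x \<in> range u"
    then show "f x = 0"
      using zero[rule_format, of "\<lambda>i. f (u i)"] \<open>inj u\<close> by (auto simp: sum.reindex)
  qed simp
qed

text \<open>Diagonal dominance in its ultrametric form. In a linear relation take
  a coefficient \<open>c m\<close> of largest absolute value and compare coordinates at \<open>m\<close>: the diagonal part
  contributes \<open>c m * z\<close>, and all errors together contribute at most \<open>fls_abs (c m) * r\<close>, which is
  strictly smaller.\<close>

lemma independent_near_scaled_axes:
  fixes u :: "'d::finite \<Rightarrow> 'a::{field,finite} fls ^ 'd"
  assumes "r < fls_abs z"
    and near: "\<And>i. fls_vec_norm (u i - axis i z) \<le> r"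
  shows "vec.independent (range u)" "card (range u) = CARD('d)"
proof -
  have zero: "c i = 0" if c: "(\<Sum>i\<in>UNIV. c i *s u i) = 0" for c i
  proof (rule ccontr)
    assume "c i \<noteq> 0"
    obtain m where m: "\<And>j. fls_abs (c j) \<le> fls_abs (c m)"
    proof -
      \<comment> \<open>a coefficient of largest absolute value\<close>
      have "finite (range (\<lambda>j. fls_abs (c j)))" by simp
      note max = Max_in[OF this] Max_ge[OF this]
      obtain m where "Max (range (\<lambda>j. fls_abs (c j))) = fls_abs (c m)"
        using max(1) by blast
      then show thesis using that[of m] max(2) by simp
    qed
    have cm: "0 < fls_abs (c m)"
      using fls_abs_pos[OF \<open>c i \<noteq> 0\<close>] m[of i] by linarith
    have r: "0 \<le> r"
      using near[of i] fls_vec_norm_nonneg order_trans by blast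
    have "(\<Sum>i\<in>UNIV. c i * (u i $ m)) = 0"
      using arg_cong[OF c, of "\<lambda>v. v $ m"] by simp
    moreover have "(\<Sum>i\<in>UNIV. c i * (axis i z $ m)) = c m * z"
      by (simp add: axis_def if_distrib cong: if_cong)
    ultimately have "c m * z = - (\<Sum>i\<in>UNIV. c i * ((u i - axis i z) $ m))"
      by (simp add: algebra_simps sum_subtractf)
    then have "fls_abs (c m * z) = fls_abs (\<Sum>i\<in>UNIV. c i * ((u i - axis i z) $ m))"
      by (simp only: fls_abs_uminus)
    then have "fls_abs (c m) * fls_abs z = fls_abs (\<Sum>i\<in>UNIV. c i * ((u i - axis i z) $ m))"
      by (simp only: fls_abs_mult)
    also have "\<dots> \<le> fls_abs (c m) * r"
    proof (rule fls_abs_sum_le)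
      fix j
      have "fls_abs ((u j - axis j z) $ m) \<le> r"
        using near fls_vec_norm_le_iff by blast
      then show "fls_abs (c j * ((u j - axis j z) $ m)) \<le> fls_abs (c m) * r"
        unfolding fls_abs_mult by (intro mult_mono m) auto
    qed (use r in simp)
    finally show False using assms(1) cm by simp
  qed
  show "vec.independent (range u)" "card (range u) = CARD('d)"
    using zero independent_range_if_scalars_zero[of u] by blast+
qed

section \<open>Comparing the two sets of radii\<close>

text \<open>The predicates under the two \<open>LEAST\<close> operators of the theorem, as predicates of the radius, so that
  they can be compared before any minimum is known to exist.\<close>

definition spanning_radius :: "('a::{field,finite} fls ^ 'd) set \<Rightarrow> real \<Rightarrow> bool" where
  "spanning_radius L r \<longleftrightarrow> r > 0 \<and>
     (\<exists>S \<subseteq> L. finite S \<and> card S = CARD('d) \<and> vec.independent S \<and> (\<forall>v\<in>S. fls_vec_norm v \<le> r))"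

definition covers_within :: "('a::{field,finite} fls ^ 'd) set \<Rightarrow> real \<Rightarrow> bool" where
  "covers_within L r \<longleftrightarrow> r > 0 \<and> {u + v |u v. u \<in> L \<and> v \<in> scaled_integer_ball r} = UNIV"

lemma covers_within_iff:
  fixes L :: "('a::{field,finite} fls ^ 'd) set"
  shows "covers_within L r \<longleftrightarrow> r > 0 \<and> (\<forall>v. \<exists>u\<in>L. fls_vec_norm (v - u) \<le> r)"
proof -
  have "v \<in> {u + v |u v. u \<in> L \<and> v \<in> scaled_integer_ball r}
      \<longleftrightarrow> (\<exists>u\<in>L. fls_vec_norm (v - u) \<le> r)" for v :: "'a fls ^ 'd"
  proof
    assume "\<exists>u\<in>L. fls_vec_norm (v - u) \<le> r"
    then obtain u where "u \<in> L" "fls_vec_norm (v - u) \<le> r" by blast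
    then show "v \<in> {u + v |u v. u \<in> L \<and> v \<in> scaled_integer_ball r}"
      unfolding scaled_integer_ball_def
      by (intro CollectI exI[of _ u] exI[of _ "v - u"]) simp
  next
    assume "v \<in> {u + v |u v. u \<in> L \<and> v \<in> scaled_integer_ball r}"
    then obtain u w where "v = u + w" "u \<in> L" "fls_vec_norm w \<le> r"
      by (auto simp: scaled_integer_ball_def)
    then show "\<exists>u\<in>L. fls_vec_norm (v - u) \<le> r"
      by (intro bexI[of _ u]) simp_all
  qed
  then show ?thesis
    unfolding covers_within_def by (simp add: set_eq_iff)
qed

text \<open>Rounding the coefficients to polynomials moves any vector to within \<open>r/q\<close> of the lattice.\<close>

lemma spanning_radius_imp_covers_within:
  fixes L :: "('a::{field,finite} fls ^ 'd) set"
  assumes "is_lattice L" "spanning_radius L r"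
  shows "covers_within L (inverse (real CARD('a)) * r)"
proof -
  obtain S where S: "S \<subseteq> L" "finite S" "card S = CARD('d)" "vec.independent S"
    "\<And>v. v \<in> S \<Longrightarrow> fls_vec_norm v \<le> r" and r: "0 < r"
    using assms(2) unfolding spanning_radius_def by blast
  have "UNIV \<subseteq> vec.span S"
    by (rule vec.card_ge_dim_independent) (use S in \<open>simp_all add: vec_dim_card card_cart_basis\<close>)
  have "\<exists>u\<in>L. fls_vec_norm (v - u) \<le> inverse (real CARD('a)) * r" for v
  proof -
    obtain c where v: "v = (\<Sum>s\<in>S. c s *s s)"
      using \<open>UNIV \<subseteq> vec.span S\<close> vec.span_finite[OF \<open>finite S\<close>] by blast
    have "\<forall>s. \<exists>p. fls_abs (c s - poly_to_fls p) \<le> inverse (real CARD('a))"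
      using poly_to_fls_fractional_part by meson
    then obtain p where p: "\<And>s. fls_abs (c s - poly_to_fls (p s)) \<le> inverse (real CARD('a))"
      by metis
    define u where "u = (\<Sum>s\<in>S. poly_to_fls (p s) *s s)"
    have "u \<in> L"
      unfolding u_def using S(1) by (intro lattice_combination[OF assms(1)]) auto
    moreover have "v - u = (\<Sum>s\<in>S. (c s - poly_to_fls (p s)) *s s)"
      by (simp add: v u_def sum_subtractf vec.scale_left_diff_distrib)
    moreover have "fls_vec_norm (\<Sum>s\<in>S. (c s - poly_to_fls (p s)) *s s) \<le> inverse (real CARD('a)) * r"
      unfolding fls_vec_norm_le_iff
    proof
      fix i
      have "fls_abs (s $ i) \<le> r" if "s \<in> S" for s
        using S(5)[OF that] fls_vec_norm_le_iff by blast
      then show "fls_abs ((\<Sum>s\<in>S. (c s - poly_to_fls (p s)) *s s) $ i) \<le> inverse (real CARD('a)) * r"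
        using r by (auto intro!: fls_abs_sum_le mult_mono p simp: fls_abs_mult)
    qed
    ultimately show ?thesis by (intro bexI[of _ u]) simp_all
  qed
  with r finite_field_card_gt_1[where 'a = 'a] show ?thesis
    by (simp add: covers_within_iff)
qed

text \<open>Lattice vectors approximating large multiples of the standard basis vectors remain independent.
  The multiple can be taken as small as the least power of \<open>q\<close> that exceeds \<open>r\<close>.\<close>

lemma covers_within_imp_spanning_radius:
  fixes L :: "('a::{field,finite} fls ^ 'd) set"
  assumes "covers_within L r"
  shows "spanning_radius L (real CARD('a) * r)"
proof -
  let ?q = "real CARD('a)"
  note q = finite_field_card_gt_1[where 'a = 'a]
  have r: "0 < r" and cov: "\<And>v. \<exists>u\<in>L. fls_vec_norm (v - u) \<le> r"
    using assms by (auto simp: covers_within_iff)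
  obtain k where k: "?q powi k \<le> r"
    "\<And>v :: 'a fls ^ 'd. fls_vec_norm v \<le> r \<longleftrightarrow> fls_vec_norm v \<le> ?q powi k"
    using radius_round_down[OF r, where 'a = 'a and 'd = 'd] by blast
  (* Any larger power would also give independent vectors; this one keeps their norms within q * r. *)
  define z :: "'a fls" where "z = fls_X_inv powi (k + 1)"
  have z: "fls_abs z = ?q * ?q powi k"
    using q unfolding z_def fls_abs_X_inv_powi by (simp add: power_int_add)
  have "\<forall>i. \<exists>u\<in>L. fls_vec_norm (axis i z - u) \<le> ?q powi k"
    using cov k(2) by blast
  then obtain u where u: "\<And>i. u i \<in> L" "\<And>i. fls_vec_norm (axis i z - u i) \<le> ?q powi k"
    by metis
  have near: "fls_vec_norm (u i - axis i z) \<le> ?q powi k" for i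
    using u(2)[of i] unfolding fls_vec_norm_le_iff
    by (metis fls_abs_uminus minus_diff_eq vector_minus_component)
  have less: "?q powi k < fls_abs z"
    using q by (simp add: z)
  have "fls_vec_norm (u i) \<le> ?q * r" for i
    unfolding fls_vec_norm_le_iff
  proof
    fix j
    have "fls_abs ((u i - axis i z) $ j) \<le> fls_abs z"
      using near[of i] less fls_abs_component_le[of "u i - axis i z" j] by linarith
    moreover have "fls_abs (axis i z $ j) \<le> fls_abs z"
      by (simp add: axis_def)
    ultimately have "fls_abs (u i $ j) \<le> fls_abs z"
      using fls_abs_add_le[of "(u i - axis i z) $ j" "axis i z $ j"] by simp
    also have "\<dots> \<le> ?q * r"
      using z k(1) q by simp
    finally show "fls_abs (u i $ j) \<le> ?q * r" .
  qed
  with u(1) r q independent_near_scaled_axes[OF less near] show ?thesis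
    unfolding spanning_radius_def by (intro conjI exI[of _ "range u"]) auto
qed

section \<open>The last successive minimum is attained\<close>

text \<open>The columns of the matrix that defines the lattice are independent lattice vectors.\<close>

lemma ex_spanning_radius:
  fixes L :: "('a::{field,finite} fls ^ 'd) set"
  assumes "is_lattice L"
  shows "\<exists>r. spanning_radius L r"
proof -
  obtain g :: "'a fls ^ 'd ^ 'd" where "invertible g"
    and L: "L = (\<lambda>v. g *v v) ` {v. \<forall>i. v $ i \<in> range poly_to_fls}"
    using assms unfolding is_lattice_def by blast
  then obtain h where h: "h ** g = mat 1"
    unfolding invertible_def by blast
  define u where "u j = column j g" for j
  have zero: "c i = 0" if c: "(\<Sum>i\<in>UNIV. c i *s u i) = 0" for c i
  proof -
    have "g *v (\<chi> j. c j) = (\<Sum>j\<in>UNIV. c j *s u j)"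
      by (simp add: u_def matrix_mult_sum)
    then have "(\<chi> j. c j) = h *v 0"
      using c h by (metis matrix_vector_mul_assoc matrix_vector_mul_lid)
    then show ?thesis by (simp add: vec_eq_iff)
  qed
  then have ind: "vec.independent (range u)" "card (range u) = CARD('d)"
    using independent_range_if_scalars_zero[of u] by blast+
  have "u j = g *v axis j 1" for j
    by (simp add: u_def vec_eq_iff matrix_vector_mult_def column_def axis_def if_distrib cong: if_cong)
  then have uL: "u j \<in> L" for j
    unfolding L by (rule image_eqI) (auto simp: range_poly_to_fls_iff axis_def)
  define R where "R = (\<Sum>j\<in>UNIV. fls_vec_norm (u j)) + 1"
  have "fls_vec_norm (u j) \<le> R" for j
    using member_le_sum[of j UNIV "\<lambda>j. fls_vec_norm (u j)"] by (simp add: R_def)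
  moreover have "0 < R"
    unfolding R_def by (intro add_nonneg_pos sum_nonneg) auto
  ultimately have "spanning_radius L R"
    unfolding spanning_radius_def using ind uL by (intro conjI exI[of _ "range u"]) auto
  then show ?thesis ..
qed

text \<open>By rounding down, only powers of \<open>q\<close> compete for the minimum, and their exponents are bounded
  below because every spanning radius is at least the norm of a nonzero lattice vector.\<close>

lemma spanning_radius_has_least:
  fixes L :: "('a::{field,finite} fls ^ 'd) set"
  assumes "is_lattice L"
  obtains m where "spanning_radius L m" "\<And>r. spanning_radius L r \<Longrightarrow> m \<le> r"
proof -
  let ?q = "real CARD('a)"
  note q = finite_field_card_gt_1[where 'a = 'a]
  obtain e where e: "0 < e" "\<And>v. v \<in> L \<Longrightarrow> v \<noteq> 0 \<Longrightarrow> e \<le> fls_vec_norm v"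
    using lattice_discrete[OF assms] by blast
  have e_le: "e \<le> r" if "spanning_radius L r" for r
  proof -
    obtain S where S: "S \<subseteq> L" "card S = CARD('d)" "vec.independent S" "\<forall>v\<in>S. fls_vec_norm v \<le> r"
      using \<open>spanning_radius L r\<close> unfolding spanning_radius_def by blast
    have "S \<noteq> {}" using S(2) by auto
    then obtain v where "v \<in> S" by blast
    moreover have "v \<noteq> 0" using S(3) \<open>v \<in> S\<close> vec.dependent_zero by blast
    ultimately show ?thesis using S e(2) by force
  qed
  have down: "\<exists>k. ?q powi k \<le> r \<and> spanning_radius L (?q powi k)" if sp: "spanning_radius L r" for r
  proof -
    have "0 < r" using sp by (simp add: spanning_radius_def)
    then obtain k where "?q powi k \<le> r"
      "\<And>v :: 'a fls ^ 'd. fls_vec_norm v \<le> r \<longleftrightarrow> fls_vec_norm v \<le> ?q powi k"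
      using radius_round_down[where 'a = 'a and 'd = 'd] by blast
    then show ?thesis
      using sp q unfolding spanning_radius_def by auto
  qed
  \<comment> \<open>a lower bound for the admissible exponents, from discreteness of the lattice\<close>
  obtain k0 where k0: "?q powi k0 \<le> e"
    using powi_floor_le[OF e(1), where 'a = 'a] by blast
  have ge: "k0 \<le> k" if "spanning_radius L (?q powi k)" for k
    using order_trans[OF k0 e_le[OF that]] by (simp add: card_powi_le_iff)
  obtain k1 where "spanning_radius L (?q powi k1)"
    using ex_spanning_radius[OF assms] down by blast
  then obtain k where k: "spanning_radius L (?q powi k)"
    "\<And>j. spanning_radius L (?q powi j) \<Longrightarrow> nat (k - k0) \<le> nat (j - k0)"
    using ex_has_least_nat[of "\<lambda>k. spanning_radius L (?q powi k)" k1 "\<lambda>k. nat (k - k0)"] by blast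
  have "?q powi k \<le> r" if sp: "spanning_radius L r" for r
  proof -
    obtain j where j: "?q powi j \<le> r" "spanning_radius L (?q powi j)"
      using down[OF sp] by blast
    have "k \<le> j" using k(2)[OF j(2)] ge[OF k(1)] ge[OF j(2)] by linarith
    then have "?q powi k \<le> ?q powi j"
      by (simp add: card_powi_le_iff)
    then show ?thesis using j(1) by linarith
  qed
  with k(1) that show thesis by blast
qed

theorem theorem1p25:
  fixes L :: "('a::{field,finite} fls ^ 'd) set"
  assumes "CARD('d) \<ge> 2"
    and "is_lattice L"
  shows "covering_radius L = inverse (real CARD('a)) * successive_minimum CARD('d) L"
proof -
  let ?q = "real CARD('a)"
  note q = finite_field_card_gt_1[where 'a = 'a]
  obtain m where m: "spanning_radius L m" "\<And>r. spanning_radius L r \<Longrightarrow> m \<le> r"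
    using spanning_radius_has_least[OF assms(2)] by blast
  have "successive_minimum CARD('d) L = (LEAST r. spanning_radius L r)"
    by (simp add: successive_minimum_def spanning_radius_def)
  also have "\<dots> = m"
    using m by (rule Least_equality)
  finally have sm: "successive_minimum CARD('d) L = m" .
  have "covering_radius L = (LEAST r. covers_within L r)"
    by (simp add: covering_radius_def covers_within_def)
  also have "\<dots> = inverse ?q * m"
  proof (rule Least_equality)
    show "covers_within L (inverse ?q * m)"
      using spanning_radius_imp_covers_within[OF assms(2) m(1)] .
    show "inverse ?q * m \<le> r" if "covers_within L r" for r
      using m(2)[OF covers_within_imp_spanning_radius[OF that]] q by (simp add: field_simps)
  qed
  finally show ?thesis by (simp add: sm)
qed

end
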